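(* The function $\mathrm{Prove}$ terminates for any input nested sequent $\Xi$.
   Context: Formulae are in negation normal form over $a,\neg a,\lor,\land,\square,\blacksquare,\lozenge,\lozenge^{\bullet}$, where $\lozenge^{\bullet}$ is the past diamond (dual of $\blacksquare$). A nested sequent is viewed as a tree whose nodes carry sets of formulae $S(u)$ and whose edges are labelled $\circ$ or $\bullet$ (children are $\circ$-children or $\bullet$-children). The deep calculus $\mathbf{DKt}$ has rules (with $\Sigma[\,]$ a context with a hole at any node): $id$: $\Sigma[a,\overline a]$; $\land$: from $\Sigma[A\land B,A]$, $\Sigma[A\land B,B]$ infer $\Sigma[A\land B]$; $\lor$: from $\Sigma[A\lor B,A,B]$ infer $\Sigma[A\lor B]$; $\blacksquare$: from $\Sigma[\blacksquare A,\bullet\{A\}]$ infer $\Sigma[\blacksquare A]$; $\square$: from $\Sigma[\square A,\circ\{A\}]$ infer $\Sigma[\square A]$; $\lozenge^{\bullet}_1$: from $\Sigma[\bullet\{\Delta,A\},\lozenge^{\bullet}A]$ infer $\Sigma[\bullet\{\Delta\},\lozenge^{\bullet}A]$; $\lozenge^{\bullet}_2$: from $\Sigma[\circ\{\Delta,\lozenge^{\bullet}A\},A]$ infer $\Sigma[\circ\{\Delta,\lozenge^{\bullet}A\}]$; $\lozenge_1$: from $\Sigma[\circ\{\Delta,A\},\lozenge A]$ infer $\Sigma[\circ\{\Delta\},\lozenge A]$; $\lozenge_2$: from $\Sigma[\bullet\{\Delta,\lozenge A\},A]$ infer $\Sigma[\bullet\{\Delta,\lozenge A\}]$. A node $u$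 is saturated if: $A\lor B\in S(u)$ implies $A,B\in S(u)$; $A\land B\in S(u)$ implies $A\in S(u)$ or $B\in S(u)$; no atom $p$ has both $p,\neg p\in S(u)$. $\square A\in S(u)$ ($\blacksquare A\in S(u)$) is realised if some $\circ$-child ($\bullet$-child) $v$ of $u$ has $A\in S(v)$. Node $u$ is propagated if: for every $\lozenge A\in S(u)$ and $\circ$-child $v$, $A\in S(v)$; for every $\lozenge^{\bullet}A\in S(u)$ and $\bullet$-child $v$, $A\in S(v)$; for every $\bullet$-child $v$ and $\lozenge A\in S(v)$, $A\in S(u)$; for every $\circ$-child $v$ and $\lozenge^{\bullet}A\in S(v)$, $A\in S(u)$. $\mathrm{Prove}(\Xi)$: let $T$ be the tree of $\Xi$. (1) If $id$ applies at some node, return True. (2) Else if some node is not saturated: if $A\lor B\in\Theta$ with $A\notin\Theta$ or $B\notin\Theta$, return $\mathrm{Prove}$ of the premise of $\lor$ applied there; if $A\land B\in\Theta$ with $A\notin\Theta$ and $B\notin\Theta$, return True iff $\mathrm{Prove}$ returns True on both premises of $\land$ applied there. (3) Else if some $\square A$ or $\blacksquare A$ at some node is not realised, return $\mathrm{Prove}$ of the premise of the $\square$ (resp. $\blacksquare$) rule applied to it. (4) Else if some node is not propagated, return $\mathrm{Prove}$ of the premise of the rule among $\lozenge_1,\lozenge^{\bullet}_1,\lozenge_2,\lozenge^{\bullet}_2$ corresponding to the violated propagation condition. (5) Else return False. *)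

theory Defs
  imports Main "HOL-Library.FSet" "HOL-Library.Multiset"
begin

datatype 'a fm =
    Atom 'a
  | NegAtom 'a
  | Or "'a fm" "'a fm"
  | And "'a fm" "'a fm"
  | Box "'a fm"
  | BBox "'a fm"
  | Dia "'a fm"
  | BDia "'a fm"

text \<open>
  \<open>BBox\<close> and \<open>BDia\<close> are the past (black) modalities. The two edge labels
  \<open>Circ\<close> and \<open>Bullet\<close> stand for the structural connectives of a nested sequent.
\<close>

datatype edge = Circ | Bullet

text \<open>
  A nested sequent is an unordered finite tree: a finite set of formulae at the root and a
  multiset of labelled subtrees. A node is identified with the subtree rooted at it.
\<close>

datatype 'a nseq = Seq (fmls: "'a fm fset") (children: "(edge \<times> 'a nseq) multiset")

text \<open>
  A context is a path to the node containing the hole. \<open>fill C N\<close> puts the whole subtree \<open>N\<close> at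
  that node, so the part of the node which belongs to the context in the notation
  \<open>\<Sigma>[A, B]\<close> appears explicitly in the rules below, as the formulae \<open>\<Gamma>\<close> and the children \<open>K\<close>.
\<close>

datatype 'a ctx = Hole | Down "'a fm fset" edge "'a ctx" "(edge \<times> 'a nseq) multiset"

primrec fill :: "'a ctx \<Rightarrow> 'a nseq \<Rightarrow> 'a nseq" where
  "fill Hole N = N"
| "fill (Down \<Gamma> e C K) N = Seq \<Gamma> (add_mset (e, fill C N) K)"

definition nodes :: "'a nseq \<Rightarrow> 'a nseq set" where
  "nodes \<Xi> = {N. \<exists>C. \<Xi> = fill C N}"

text \<open>
  The rules of \<open>DKt\<close> at the hole. \<open>dkt r Ps N\<close> means that \<open>fill C N\<close> follows from the
  premises \<open>map (fill C) Ps\<close> by rule \<open>r\<close>, for every context \<open>C\<close>. The rule name records the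
  formulae involved and, for \<open>Dia1R\<close> and \<open>BDia1R\<close>, the child into which \<open>A\<close> is propagated.
\<close>

datatype 'a rule =
    IdR 'a
  | OrR "'a fm" "'a fm"
  | AndR "'a fm" "'a fm"
  | BoxR "'a fm"
  | BBoxR "'a fm"
  | Dia1R "'a fm" "'a nseq"
  | BDia1R "'a fm" "'a nseq"
  | Dia2R "'a fm"
  | BDia2R "'a fm"

inductive dkt :: "'a rule \<Rightarrow> 'a nseq list \<Rightarrow> 'a nseq \<Rightarrow> bool" where
  "dkt (IdR a) [] (Seq (finsert (Atom a) (finsert (NegAtom a) \<Gamma>)) K)"
| "dkt (OrR A B)
     [Seq (finsert (Or A B) (finsert A (finsert B \<Gamma>))) K]
     (Seq (finsert (Or A B) \<Gamma>) K)"
| "dkt (AndR A B)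
     [Seq (finsert (And A B) (finsert A \<Gamma>)) K, Seq (finsert (And A B) (finsert B \<Gamma>)) K]
     (Seq (finsert (And A B) \<Gamma>) K)"
| "dkt (BoxR A)
     [Seq (finsert (Box A) \<Gamma>) (add_mset (Circ, Seq {|A|} {#}) K)]
     (Seq (finsert (Box A) \<Gamma>) K)"
| "dkt (BBoxR A)
     [Seq (finsert (BBox A) \<Gamma>) (add_mset (Bullet, Seq {|A|} {#}) K)]
     (Seq (finsert (BBox A) \<Gamma>) K)"
| "dkt (Dia1R A (Seq \<Delta> L))
     [Seq (finsert (Dia A) \<Gamma>) (add_mset (Circ, Seq (finsert A \<Delta>) L) K)]
     (Seq (finsert (Dia A) \<Gamma>) (add_mset (Circ, Seq \<Delta> L) K))"
| "dkt (BDia1R A (Seq \<Delta> L))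
     [Seq (finsert (BDia A) \<Gamma>) (add_mset (Bullet, Seq (finsert A \<Delta>) L) K)]
     (Seq (finsert (BDia A) \<Gamma>) (add_mset (Bullet, Seq \<Delta> L) K))"
| "dkt (Dia2R A)
     [Seq (finsert A \<Gamma>) (add_mset (Bullet, Seq (finsert (Dia A) \<Delta>) L) K)]
     (Seq \<Gamma> (add_mset (Bullet, Seq (finsert (Dia A) \<Delta>) L) K))"
| "dkt (BDia2R A)
     [Seq (finsert A \<Gamma>) (add_mset (Circ, Seq (finsert (BDia A) \<Delta>) L) K)]
     (Seq \<Gamma> (add_mset (Circ, Seq (finsert (BDia A) \<Delta>) L) K))"

definition saturated :: "'a nseq \<Rightarrow> bool" where
  "saturated u \<longleftrightarrow>
     (\<forall>A B. Or A B |\<in>| fmls u \<longrightarrow> A |\<in>| fmls u \<and> B |\<in>| fmls u) \<and>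
     (\<forall>A B. And A B |\<in>| fmls u \<longrightarrow> A |\<in>| fmls u \<or> B |\<in>| fmls u) \<and>
     (\<forall>p. \<not> (Atom p |\<in>| fmls u \<and> NegAtom p |\<in>| fmls u))"

definition box_realised :: "'a nseq \<Rightarrow> 'a fm \<Rightarrow> bool" where
  "box_realised u A \<longleftrightarrow> (\<exists>v. (Circ, v) \<in># children u \<and> A |\<in>| fmls v)"

definition bbox_realised :: "'a nseq \<Rightarrow> 'a fm \<Rightarrow> bool" where
  "bbox_realised u A \<longleftrightarrow> (\<exists>v. (Bullet, v) \<in># children u \<and> A |\<in>| fmls v)"

definition realised :: "'a nseq \<Rightarrow> bool" where
  "realised u \<longleftrightarrow>
     (\<forall>A. Box A |\<in>| fmls u \<longrightarrow> box_realised u A) \<and>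
     (\<forall>A. BBox A |\<in>| fmls u \<longrightarrow> bbox_realised u A)"

definition propagated :: "'a nseq \<Rightarrow> bool" where
  "propagated u \<longleftrightarrow>
     (\<forall>A v. Dia A |\<in>| fmls u \<and> (Circ, v) \<in># children u \<longrightarrow> A |\<in>| fmls v) \<and>
     (\<forall>A v. BDia A |\<in>| fmls u \<and> (Bullet, v) \<in># children u \<longrightarrow> A |\<in>| fmls v) \<and>
     (\<forall>A v. (Bullet, v) \<in># children u \<and> Dia A |\<in>| fmls v \<longrightarrow> A |\<in>| fmls u) \<and>
     (\<forall>A v. (Circ, v) \<in># children u \<and> BDia A |\<in>| fmls v \<longrightarrow> A |\<in>| fmls u)"

definition id_applies :: "'a nseq \<Rightarrow> bool" where
  "id_applies \<Xi> \<longleftrightarrow> (\<exists>u\<in>nodes \<Xi>. \<exists>a. dkt (IdR a) [] u)"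

text \<open>
  What one execution of the body of \<open>Prove\<close> does: return a value, return the value of one
  recursive call, or return the conjunction of the values of two recursive calls.
\<close>

datatype 'a action = Return bool | Call "'a nseq" | CallBoth "'a nseq" "'a nseq"

primrec calls :: "'a action \<Rightarrow> 'a nseq set" where
  "calls (Return b) = {}"
| "calls (Call \<Xi>) = {\<Xi>}"
| "calls (CallBoth \<Xi>1 \<Xi>2) = {\<Xi>1, \<Xi>2}"

text \<open>
  \<open>Prove\<close> does not prescribe which node, formula or child is treated first within a stage, so
  its body is a relation: \<open>prove_body \<Xi> act\<close> means that \<open>act\<close> is a possible action of the body
  on input \<open>\<Xi>\<close>. The order of the stages is enforced by the guards.
\<close>

inductive prove_body :: "'a nseq \<Rightarrow> 'a action \<Rightarrow> bool" where
  id: "id_applies \<Xi> \<Longrightarrow> prove_body \<Xi> (Return True)"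
| disj: "\<lbrakk>\<not> id_applies \<Xi>;
    \<Xi> = fill C u; Or A B |\<in>| fmls u; A |\<notin>| fmls u \<or> B |\<notin>| fmls u;
    dkt (OrR A B) [P] u\<rbrakk> \<Longrightarrow> prove_body \<Xi> (Call (fill C P))"
| conj: "\<lbrakk>\<not> id_applies \<Xi>;
    \<Xi> = fill C u; And A B |\<in>| fmls u; A |\<notin>| fmls u; B |\<notin>| fmls u;
    dkt (AndR A B) [P, Q] u\<rbrakk> \<Longrightarrow> prove_body \<Xi> (CallBoth (fill C P) (fill C Q))"
| box: "\<lbrakk>\<not> id_applies \<Xi>; \<forall>w\<in>nodes \<Xi>. saturated w;
    \<Xi> = fill C u; Box A |\<in>| fmls u; \<not> box_realised u A;
    dkt (BoxR A) [P] u\<rbrakk> \<Longrightarrow> prove_body \<Xi> (Call (fill C P))"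
| bbox: "\<lbrakk>\<not> id_applies \<Xi>; \<forall>w\<in>nodes \<Xi>. saturated w;
    \<Xi> = fill C u; BBox A |\<in>| fmls u; \<not> bbox_realised u A;
    dkt (BBoxR A) [P] u\<rbrakk> \<Longrightarrow> prove_body \<Xi> (Call (fill C P))"
| dia1: "\<lbrakk>\<not> id_applies \<Xi>; \<forall>w\<in>nodes \<Xi>. saturated w \<and> realised w;
    \<Xi> = fill C u; Dia A |\<in>| fmls u; (Circ, v) \<in># children u; A |\<notin>| fmls v;
    dkt (Dia1R A v) [P] u\<rbrakk> \<Longrightarrow> prove_body \<Xi> (Call (fill C P))"
| bdia1: "\<lbrakk>\<not> id_applies \<Xi>; \<forall>w\<in>nodes \<Xi>. saturated w \<and> realised w;
    \<Xi> = fill C u; BDia A |\<in>| fmls u; (Bullet, v) \<in># children u; A |\<notin>| fmls v;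
    dkt (BDia1R A v) [P] u\<rbrakk> \<Longrightarrow> prove_body \<Xi> (Call (fill C P))"
| dia2: "\<lbrakk>\<not> id_applies \<Xi>; \<forall>w\<in>nodes \<Xi>. saturated w \<and> realised w;
    \<Xi> = fill C u; (Bullet, v) \<in># children u; Dia A |\<in>| fmls v; A |\<notin>| fmls u;
    dkt (Dia2R A) [P] u\<rbrakk> \<Longrightarrow> prove_body \<Xi> (Call (fill C P))"
| bdia2: "\<lbrakk>\<not> id_applies \<Xi>; \<forall>w\<in>nodes \<Xi>. saturated w \<and> realised w;
    \<Xi> = fill C u; (Circ, v) \<in># children u; BDia A |\<in>| fmls v; A |\<notin>| fmls u;
    dkt (BDia2R A) [P] u\<rbrakk> \<Longrightarrow> prove_body \<Xi> (Call (fill C P))"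
| fail: "\<lbrakk>\<not> id_applies \<Xi>; \<forall>w\<in>nodes \<Xi>. saturated w \<and> realised w \<and> propagated w\<rbrakk>
    \<Longrightarrow> prove_body \<Xi> (Return False)"

text \<open>
  Termination on input \<open>\<Xi>\<close> however the choices are resolved: the body always has an action to
  perform, and every recursive call it may make terminates. Being the least such predicate, it
  excludes infinite chains of recursive calls.
\<close>

inductive prove_terminates :: "'a nseq \<Rightarrow> bool" where
  "\<lbrakk>\<exists>act. prove_body \<Xi> act;
    \<And>act \<Xi>'. \<lbrakk>prove_body \<Xi> act; \<Xi>' \<in> calls act\<rbrakk> \<Longrightarrow> prove_terminates \<Xi>'\<rbrakk>
   \<Longrightarrow> prove_terminates \<Xi>"

end

theory Submission imports Defs begin

text \<open>
  Every call adds a subformula of the input to a node or creates a child realising a box formula.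
  Modal degree bounds the depth of the tree: a child created below a node of degree at most \<open>d\<close>
  only ever receives formulae of degree at most \<open>d - 1\<close>, and what it propagates upwards has
  smaller degree still. Hence the total work that a new child can ever require is bounded in
  advance by a constant depending only on \<open>d\<close> and on the number of subformulae; charging that
  constant to every box formula that is not yet realised gives a natural number which decreases
  with each call.
\<close>

section \<open>Subformulae and modal degree\<close>

primrec subfms :: "'a fm \<Rightarrow> 'a fm set" where
  "subfms (Atom a) = {Atom a}"
| "subfms (NegAtom a) = {NegAtom a}"
| "subfms (Or A B) = insert (Or A B) (subfms A \<union> subfms B)"
| "subfms (And A B) = insert (And A B) (subfms A \<union> subfms B)"
| "subfms (Box A) = insert (Box A) (subfms A)"
| "subfms (BBox A) = insert (BBox A) (subfms A)"
| "subfms (Dia A) = insert (Dia A) (subfms A)"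
| "subfms (BDia A) = insert (BDia A) (subfms A)"

lemma finite_subfms: "finite (subfms A)"
  by (induction A) auto

lemma subfms_refl: "A \<in> subfms A"
  by (cases A) auto

lemma subfms_trans: "B \<in> subfms A \<Longrightarrow> subfms B \<subseteq> subfms A"
  by (induction A) auto

primrec degree :: "'a fm \<Rightarrow> nat" where
  "degree (Atom a) = 0"
| "degree (NegAtom a) = 0"
| "degree (Or A B) = max (degree A) (degree B)"
| "degree (And A B) = max (degree A) (degree B)"
| "degree (Box A) = Suc (degree A)"
| "degree (BBox A) = Suc (degree A)"
| "degree (Dia A) = Suc (degree A)"
| "degree (BDia A) = Suc (degree A)"

lemma degree_subfms: "B \<in> subfms A \<Longrightarrow> degree B \<le> degree A"
  by (induction A) auto

section \<open>The formulae occurring in a nested sequent and their maximal degree\<close>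

definition all_fmls :: "'a nseq \<Rightarrow> 'a fm set" where
  "all_fmls N = (\<Union>u\<in>nodes N. fset (fmls u))"

text \<open>Splitting the path of a context at its first edge turns the context-based notion of node
  into a recursion along the tree.\<close>

lemma nodes_Seq: "nodes (Seq \<Gamma> K) = insert (Seq \<Gamma> K) (\<Union>(e, c)\<in>set_mset K. nodes c)"
proof (intro set_eqI iffI)
  fix u assume "u \<in> nodes (Seq \<Gamma> K)"
  then obtain C where C: "Seq \<Gamma> K = fill C u"
    by (auto simp: nodes_def)
  then show "u \<in> insert (Seq \<Gamma> K) (\<Union>(e, c)\<in>set_mset K. nodes c)"
    by (cases C) (force simp: nodes_def)+
next
  fix u assume u: "u \<in> insert (Seq \<Gamma> K) (\<Union>(e, c)\<in>set_mset K. nodes c)"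
  show "u \<in> nodes (Seq \<Gamma> K)"
  proof (cases "u = Seq \<Gamma> K")
    case True
    then have "Seq \<Gamma> K = fill Hole u" by simp
    then show ?thesis unfolding nodes_def by blast
  next
    case False
    with u obtain e C where "(e, fill C u) \<in># K"
      by (auto simp: nodes_def)
    then obtain K' where "K = add_mset (e, fill C u) K'"
      by (meson multi_member_split)
    then have "Seq \<Gamma> K = fill (Down \<Gamma> e C K') u" by simp
    then show ?thesis unfolding nodes_def by blast
  qed
qed

lemma all_fmls_Seq [simp]:
  "all_fmls (Seq \<Gamma> K) = fset \<Gamma> \<union> (\<Union>(e, c)\<in>set_mset K. all_fmls c)"
  by (auto simp: all_fmls_def nodes_Seq)

lemma finite_all_fmls [simp]: "finite (all_fmls N)"
proof (induction N)
  case (Seq \<Gamma> K)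
  have "finite (all_fmls c)" if "(e, c) \<in># K" for e c
    using Seq.IH[OF that] by simp
  then show ?case by auto
qed

text \<open>The inserted 0 gives \<open>Max\<close> a value on a tree without formulae.\<close>

definition max_degree :: "'a nseq \<Rightarrow> nat" where
  "max_degree N = Max (insert 0 (degree ` all_fmls N))"

lemma degree_le_max_degree: "A \<in> all_fmls N \<Longrightarrow> degree A \<le> max_degree N"
  by (simp add: max_degree_def)

lemma max_degree_le_iff: "max_degree N \<le> d \<longleftrightarrow> (\<forall>A\<in>all_fmls N. degree A \<le> d)"
  by (simp add: max_degree_def)

lemma max_degree_mono: "all_fmls M \<subseteq> all_fmls N \<Longrightarrow> max_degree M \<le> max_degree N"
  by (meson max_degree_le_iff order_refl subsetD)

section \<open>The measure, relative to a finite subformula-closed set\<close>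

locale closed_fmls =
  fixes F :: "'a fm set"
  assumes finite_F: "finite F"
    and closed_F: "A \<in> F \<Longrightarrow> subfms A \<subseteq> F"
begin

text \<open>\<open>box_cost (Suc d)\<close> is one more than a bound on the work of a fresh leaf
  with degree bound \<open>d\<close>: at most \<open>card F\<close> missing formulae, and at most
  \<open>card F\<close> unrealised boxes at \<open>box_cost d\<close> each. A node with bound 0
  holds no box formula, hence the charge 0.\<close>

primrec box_cost :: "nat \<Rightarrow> nat" where
  "box_cost 0 = 0"
| "box_cost (Suc d) = Suc (card F + box_cost d * card F)"

text \<open>Ranging over all of \<open>F\<close>, not just over the formulae of \<open>u\<close>,
  means that a box formula arriving at \<open>u\<close> later causes no new charge: it has been paid
  for from the start.\<close>

definition unrealised :: "'a nseq \<Rightarrow> 'a fm set" where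
  "unrealised u =
     {X \<in> F. (\<exists>A. X = Box A \<and> \<not> box_realised u A) \<or> (\<exists>A. X = BBox A \<and> \<not> bbox_realised u A)}"

text \<open>
  The argument \<open>d\<close> bounds the degree that the formulae of the subtree can ever reach. The maximum
  accounts for the subtrees of the input, which need not have smaller degree than their parent.
\<close>

function work :: "nat \<Rightarrow> 'a nseq \<Rightarrow> nat" where
  "work d (Seq \<Gamma> K) = card (F - fset \<Gamma>) + box_cost d * card (unrealised (Seq \<Gamma> K))
     + (\<Sum>x\<in>#K. work (max (d - 1) (max_degree (snd x))) (snd x))"
  by pat_completeness auto
termination
proof (relation "measure (\<lambda>(d, N). size N)")
  fix d :: nat and \<Gamma> :: "'a fm fset" and K and x :: "edge \<times> 'a nseq"
  assume "x \<in># K"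
  then obtain K' where "K = add_mset x K'"
    by (meson multi_member_split)
  then show "((max (d - 1) (max_degree (snd x)), snd x), d, Seq \<Gamma> K)
      \<in> measure (\<lambda>(d, N). size N)"
    by (cases x) (simp add: size_multiset_overloaded_eq)
qed simp

declare work.simps [simp del]

text \<open>Designed to survive contexts. Larger root formulae keep realised the boxes of the
  parent, an equal \<open>max_degree\<close> preserves the bounds assigned by ancestors, and
  \<open>d\<close> varies because such a bound may exceed the node's own maximal degree.\<close>

definition improves :: "'a nseq \<Rightarrow> 'a nseq \<Rightarrow> bool" where
  "improves u P \<longleftrightarrow> fmls u |\<subseteq>| fmls P \<and> all_fmls P \<subseteq> F \<and> max_degree P = max_degree u \<and>
     (\<forall>d\<ge>max_degree u. work d P < work d u)"

section \<open>Lifting a decrease from one node to the whole sequent\<close>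

lemma unrealised_Seq_anti:
  assumes "fmls N |\<subseteq>| fmls N'"
  shows "unrealised (Seq \<Gamma>' (add_mset (e, N') K)) \<subseteq> unrealised (Seq \<Gamma> (add_mset (e, N) K))"
  using assms by (force simp: unrealised_def box_realised_def bbox_realised_def)

lemma finite_unrealised: "finite (unrealised u)"
  using finite_F by (simp add: unrealised_def)

lemma work_child:
  assumes "fmls N |\<subseteq>| fmls N'"
    and "max (d - 1) (max_degree N') = max (d - 1) (max_degree N)"
    and "work (max (d - 1) (max_degree N)) N' < work (max (d - 1) (max_degree N)) N"
  shows "work d (Seq \<Gamma> (add_mset (e, N') K)) < work d (Seq \<Gamma> (add_mset (e, N) K))"
proof -
  have "card (unrealised (Seq \<Gamma> (add_mset (e, N') K)))
      \<le> card (unrealised (Seq \<Gamma> (add_mset (e, N) K)))"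
    by (intro card_mono finite_unrealised unrealised_Seq_anti assms(1))
  then show ?thesis
    using assms(2,3) by (simp add: work.simps add_le_less_mono)
qed

lemma improves_fill:
  assumes "improves u P" and "all_fmls (fill C u) \<subseteq> F"
  shows "improves (fill C u) (fill C P)"
  using assms(2)
proof (induction C)
  case Hole
  then show ?case using assms(1) by simp
next
  case (Down \<Gamma> e C K)
  let ?N = "fill C u" and ?N' = "fill C P"
  have IH: "improves ?N ?N'"
    using Down by auto
  have deg: "max_degree (Seq \<Gamma> (add_mset (e, ?N') K)) = max_degree (Seq \<Gamma> (add_mset (e, ?N) K))"
  proof -
    \<comment> \<open>Two natural numbers with the same upper bounds are equal, so it suffices to
      compare the bounds \<open>d\<close>.\<close>
    have "(\<forall>A\<in>all_fmls ?N'. degree A \<le> d) \<longleftrightarrow> (\<forall>A\<in>all_fmls ?N. degree A \<le> d)" for d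
      using IH by (metis improves_def max_degree_le_iff)
    then have "max_degree (Seq \<Gamma> (add_mset (e, ?N') K)) \<le> d
        \<longleftrightarrow> max_degree (Seq \<Gamma> (add_mset (e, ?N) K)) \<le> d" for d
      unfolding max_degree_le_iff all_fmls_Seq by (simp add: ball_Un)
    then show ?thesis by (metis order_antisym order_refl)
  qed
  \<comment> \<open>No lower bound on \<open>d\<close> is required: the bound handed down to the
    child is a maximum with \<open>max_degree ?N\<close>, so the induction hypothesis applies to
    it.\<close>
  have "work d (Seq \<Gamma> (add_mset (e, ?N') K)) < work d (Seq \<Gamma> (add_mset (e, ?N) K))" for d
    using IH by (intro work_child) (auto simp: improves_def)
  then show ?case
    using IH Down.prems deg by (auto simp: improves_def)
qed

section \<open>The decrease caused by one rule application at a node\<close>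

lemma work_add_fmls:
  assumes "\<Gamma> |\<subset>| \<Gamma>'" and "fset \<Gamma>' \<subseteq> F"
  shows "work d (Seq \<Gamma>' K) < work d (Seq \<Gamma> K)"
proof -
  have "F - fset \<Gamma>' \<subset> F - fset \<Gamma>"
    using assms by blast
  then have "card (F - fset \<Gamma>') < card (F - fset \<Gamma>)"
    using finite_F by (simp add: psubset_card_mono)
  moreover have "unrealised (Seq \<Gamma>' K) = unrealised (Seq \<Gamma> K)"
    by (simp add: unrealised_def box_realised_def bbox_realised_def)
  ultimately show ?thesis by (simp add: work.simps)
qed

lemma subfms_subset_F: "A \<in> all_fmls N \<Longrightarrow> all_fmls N \<subseteq> F \<Longrightarrow> subfms A \<subseteq> F"
  using closed_F by blast

text \<open>Subformulae of a formula already in the tree stay in \<open>F\<close> and do not raise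
  the maximal degree. Letting \<open>X\<close> lie anywhere in the subtree covers upward propagation
  from a child as well as the propositional rules.\<close>

lemma improves_add_fmls:
  assumes "all_fmls (Seq \<Gamma> K) \<subseteq> F" and "\<Gamma> |\<subseteq>| \<Gamma>'" and "\<not> \<Gamma>' |\<subseteq>| \<Gamma>"
    and "X \<in> all_fmls (Seq \<Gamma> K)" and "fset \<Gamma>' \<subseteq> fset \<Gamma> \<union> subfms X"
  shows "improves (Seq \<Gamma> K) (Seq \<Gamma>' K)"
proof -
  have "all_fmls (Seq \<Gamma>' K) \<subseteq> all_fmls (Seq \<Gamma> K) \<union> subfms X"
    using assms(5) by auto
  then have F: "all_fmls (Seq \<Gamma>' K) \<subseteq> F"
    and "\<forall>A\<in>all_fmls (Seq \<Gamma>' K). degree A \<le> max_degree (Seq \<Gamma> K)"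
    using subfms_subset_F[OF assms(4,1)] assms(1) degree_le_max_degree degree_subfms
      degree_le_max_degree[OF assms(4)]
    by (blast, meson UnE order_trans subsetD)
  then have "max_degree (Seq \<Gamma>' K) \<le> max_degree (Seq \<Gamma> K)"
    by (simp add: max_degree_le_iff del: all_fmls_Seq)
  moreover have "max_degree (Seq \<Gamma> K) \<le> max_degree (Seq \<Gamma>' K)"
    using assms(2) by (intro max_degree_mono) auto
  moreover have "work d (Seq \<Gamma>' K) < work d (Seq \<Gamma> K)" for d
    using F assms(2,3) by (intro work_add_fmls) (simp_all add: less_le_not_le)
  ultimately show ?thesis
    using F assms(2) by (simp add: improves_def del: all_fmls_Seq)
qed

text \<open>The box \<open>X\<close> leaves \<open>unrealised\<close>, which frees one
  \<open>box_cost d\<close>, and this strictly exceeds the work of the new leaf. Phrasing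
  realisation through \<open>unrealised\<close> serves both colours at once.\<close>

lemma improves_new_child:
  assumes "all_fmls (Seq \<Gamma> K) \<subseteq> F" and "X |\<in>| \<Gamma>" and "A \<in> subfms X"
    and "degree X = Suc (degree A)"
    and "X \<in> unrealised (Seq \<Gamma> K)"
    and "X \<notin> unrealised (Seq \<Gamma> (add_mset (e, Seq {|A|} {#}) K))"
  shows "improves (Seq \<Gamma> K) (Seq \<Gamma> (add_mset (e, Seq {|A|} {#}) K))"
proof -
  let ?c = "Seq {|A|} {#}"
  let ?P = "Seq \<Gamma> (add_mset (e, ?c) K)"
  have A: "A \<in> F"
    using subfms_subset_F[OF _ assms(1)] assms(2,3) by auto
  have degX: "degree X \<le> max_degree (Seq \<Gamma> K)"
    using assms(2) by (intro degree_le_max_degree) simp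
  have "max_degree ?P \<le> max_degree (Seq \<Gamma> K)"
    unfolding max_degree_le_iff[of ?P] using degree_le_max_degree[of _ "Seq \<Gamma> K"] degX assms(4) by auto
  moreover have "max_degree (Seq \<Gamma> K) \<le> max_degree ?P"
    by (intro max_degree_mono) auto
  moreover have "work d ?P < work d (Seq \<Gamma> K)" if d: "d \<ge> max_degree (Seq \<Gamma> K)" for d
  proof -
    \<comment> \<open>Since \<open>Suc (degree A) = degree X \<le> d\<close>, the bound is a
      successor, and the new child receives exactly the predecessor \<open>d'\<close>.\<close>
    obtain d' where d': "d = Suc d'"
      using degX d assms(4) by (cases d) auto
    have "max_degree ?c = degree A"
      by (simp add: max_degree_def)
    then have D: "max (d - 1) (max_degree ?c) = d'"
      using degX d d' assms(4) by simp
    have "unrealised ?P \<subseteq> unrealised (Seq \<Gamma> K)"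
      by (auto simp: unrealised_def box_realised_def bbox_realised_def)
    then have "unrealised ?P \<subset> unrealised (Seq \<Gamma> K)"
      using assms(5,6) by blast
    then have "card (unrealised ?P) < card (unrealised (Seq \<Gamma> K))"
      by (intro psubset_card_mono finite_unrealised)
    then have "box_cost d * Suc (card (unrealised ?P)) \<le> box_cost d * card (unrealised (Seq \<Gamma> K))"
      by (intro mult_le_mono2) simp
    moreover have "card (F - fset {|A|}) \<le> card F" "card (unrealised ?c) \<le> card F"
      using finite_F by (auto intro!: card_mono simp: unrealised_def)
    \<comment> \<open>The leaf has no children, so only the two estimates just made contribute; the
      outer \<open>Suc\<close> in \<open>box_cost\<close> makes the inequality strict.\<close>
    then have "work d' ?c < box_cost d"
      by (simp add: work.simps d' add_mono mult.commute less_Suc_eq_le del: card_Diff_insert)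
    ultimately show ?thesis
      using D by (simp add: work.simps)
  qed
  ultimately show ?thesis
    using assms(1) A by (auto simp: improves_def)
qed

text \<open>The maximal degree of the child may rise, so \<open>improves\<close> can fail for the
  child taken alone. The argument is therefore made at the parent, where \<open>X\<close> already
  accounts for the degree of \<open>A\<close>.\<close>

lemma improves_child:
  assumes "all_fmls (Seq \<Gamma> (add_mset (e, Seq \<Delta> L) K)) \<subseteq> F"
    and "X |\<in>| \<Gamma>" and "A \<in> subfms X" and "degree X = Suc (degree A)" and "A |\<notin>| \<Delta>"
  shows "improves (Seq \<Gamma> (add_mset (e, Seq \<Delta> L) K))
    (Seq \<Gamma> (add_mset (e, Seq (finsert A \<Delta>) L) K))"
    (is "improves ?u ?P")
proof -
  let ?c = "Seq \<Delta> L" and ?c' = "Seq (finsert A \<Delta>) L"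
  have A: "A \<in> F"
    using subfms_subset_F[OF _ assms(1)] assms(2,3) by auto
  have degX: "degree X \<le> max_degree ?u"
    using assms(2) by (intro degree_le_max_degree) simp
  have "max_degree ?P \<le> max_degree ?u"
    unfolding max_degree_le_iff[of ?P] using degree_le_max_degree[of _ ?u] degX assms(4) by auto
  moreover have "max_degree ?u \<le> max_degree ?P"
    by (intro max_degree_mono) auto
  moreover have "work d ?P < work d ?u" if d: "d \<ge> max_degree ?u" for d
  proof (rule work_child)
    have "max_degree ?c \<le> max_degree ?c'"
      by (intro max_degree_mono) auto
    \<comment> \<open>\<open>A\<close> has degree at most \<open>d - 1\<close>, because
      \<open>X\<close> at the parent has degree at most \<open>d\<close>. The maximum absorbs any
      growth, so the child is measured with the same bound before and after.\<close>
    moreover have "max_degree ?c' \<le> max (d - 1) (max_degree ?c)"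
      unfolding max_degree_le_iff[of ?c'] using degree_le_max_degree[of _ ?c] degX assms(4) d
      by (auto simp: le_max_iff_disj)
    ultimately show "max (d - 1) (max_degree ?c') = max (d - 1) (max_degree ?c)"
      by simp
  next
    show "work (max (d - 1) (max_degree ?c)) ?c' < work (max (d - 1) (max_degree ?c)) ?c"
      using assms(1,5) A by (intro work_add_fmls) auto
  qed auto
  ultimately show ?thesis
    using assms(1) A by (auto simp: improves_def)
qed

section \<open>Every recursive call decreases the measure\<close>

lemma prove_body_improves:
  assumes "prove_body \<Xi> act" and "\<Xi>' \<in> calls act" and "all_fmls \<Xi> \<subseteq> F"
  shows "improves \<Xi> \<Xi>'"
proof -
  have sub: "all_fmls u \<subseteq> F" if "\<Xi> = fill C u" for C u
  proof -
    have "all_fmls u \<subseteq> all_fmls (fill C u)"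
      by (induction C) auto
    then show ?thesis using that assms(3) by simp
  qed
  \<comment> \<open>This reduces each case to the node at which the rule acts.\<close>
  have lift: "improves \<Xi> \<Xi>'" if "\<Xi> = fill C u" "improves u P" "\<Xi>' = fill C P" for C u P
    using improves_fill that assms(3) by blast
  show ?thesis
    using assms(1)
  proof cases
    case (disj C u A B P)
    obtain \<Gamma> K where u: "u = Seq (finsert (Or A B) \<Gamma>) K"
      and P: "P = Seq (finsert (Or A B) (finsert A (finsert B \<Gamma>))) K"
      using disj(6) by cases auto
    have "improves u P"
      using sub[OF disj(3)] disj(5) unfolding u P
      by (intro improves_add_fmls[where X = "Or A B"]) (auto simp: subfms_refl)
    moreover have "\<Xi>' = fill C P"
      using disj(1) assms(2) by simp
    ultimately show ?thesis
      by (rule lift[OF disj(3)])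
  next
    case (conj C u A B P Q)
    obtain \<Gamma> K where u: "u = Seq (finsert (And A B) \<Gamma>) K"
      and P: "P = Seq (finsert (And A B) (finsert A \<Gamma>)) K"
      and Q: "Q = Seq (finsert (And A B) (finsert B \<Gamma>)) K"
      using conj(7) by cases auto
    \<comment> \<open>The guard excludes both conjuncts, so each of the two calls adds a new
      formula.\<close>
    have "improves u P"
      using sub[OF conj(3)] conj(5) unfolding u P
      by (intro improves_add_fmls[where X = "And A B"]) (auto simp: subfms_refl)
    moreover have "improves u Q"
      using sub[OF conj(3)] conj(6) unfolding u Q
      by (intro improves_add_fmls[where X = "And A B"]) (auto simp: subfms_refl)
    moreover have "\<Xi>' = fill C P \<or> \<Xi>' = fill C Q"
      using conj(1) assms(2) by simp
    ultimately show ?thesis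
      using lift[OF conj(3)] by blast
  next
    case (box C u A P)
    obtain \<Gamma> K where u: "u = Seq (finsert (Box A) \<Gamma>) K"
      and P: "P = Seq (finsert (Box A) \<Gamma>) (add_mset (Circ, Seq {|A|} {#}) K)"
      using box(7) by cases auto
    have "Box A \<in> unrealised u"
      using sub[OF box(4)] box(6) by (simp add: u unrealised_def)
    moreover have "Box A \<notin> unrealised P"
      by (auto simp: P unrealised_def box_realised_def)
    ultimately have "improves u P"
      using sub[OF box(4)] unfolding u P
      by (intro improves_new_child[where X = "Box A"]) (simp_all add: subfms_refl)
    moreover have "\<Xi>' = fill C P"
      using box(1) assms(2) by simp
    ultimately show ?thesis
      by (rule lift[OF box(4)])
  next
    case (bbox C u A P)
    obtain \<Gamma> K where u: "u = Seq (finsert (BBox A) \<Gamma>) K"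
      and P: "P = Seq (finsert (BBox A) \<Gamma>) (add_mset (Bullet, Seq {|A|} {#}) K)"
      using bbox(7) by cases auto
    have "BBox A \<in> unrealised u"
      using sub[OF bbox(4)] bbox(6) by (simp add: u unrealised_def)
    moreover have "BBox A \<notin> unrealised P"
      by (auto simp: P unrealised_def bbox_realised_def)
    ultimately have "improves u P"
      using sub[OF bbox(4)] unfolding u P
      by (intro improves_new_child[where X = "BBox A"]) (simp_all add: subfms_refl)
    moreover have "\<Xi>' = fill C P"
      using bbox(1) assms(2) by simp
    ultimately show ?thesis
      by (rule lift[OF bbox(4)])
  next
    case (dia1 C u A v P)
    obtain \<Gamma> \<Delta> L K where u: "u = Seq (finsert (Dia A) \<Gamma>) (add_mset (Circ, Seq \<Delta> L) K)"
      and P: "P = Seq (finsert (Dia A) \<Gamma>) (add_mset (Circ, Seq (finsert A \<Delta>) L) K)"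
      and v: "v = Seq \<Delta> L"
      using dia1(8) by cases auto
    have "improves u P"
      using sub[OF dia1(4)] dia1(7) unfolding u P v
      by (intro improves_child[where X = "Dia A"]) (auto simp: subfms_refl)
    moreover have "\<Xi>' = fill C P"
      using dia1(1) assms(2) by simp
    ultimately show ?thesis
      by (rule lift[OF dia1(4)])
  next
    case (bdia1 C u A v P)
    obtain \<Gamma> \<Delta> L K where u: "u = Seq (finsert (BDia A) \<Gamma>) (add_mset (Bullet, Seq \<Delta> L) K)"
      and P: "P = Seq (finsert (BDia A) \<Gamma>) (add_mset (Bullet, Seq (finsert A \<Delta>) L) K)"
      and v: "v = Seq \<Delta> L"
      using bdia1(8) by cases auto
    have "improves u P"
      using sub[OF bdia1(4)] bdia1(7) unfolding u P v
      by (intro improves_child[where X = "BDia A"]) (auto simp: subfms_refl)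
    moreover have "\<Xi>' = fill C P"
      using bdia1(1) assms(2) by simp
    ultimately show ?thesis
      by (rule lift[OF bdia1(4)])
  next
    case (dia2 C u v A P)
    obtain \<Gamma> \<Delta> L K where u: "u = Seq \<Gamma> (add_mset (Bullet, Seq (finsert (Dia A) \<Delta>) L) K)"
      and P: "P = Seq (finsert A \<Gamma>) (add_mset (Bullet, Seq (finsert (Dia A) \<Delta>) L) K)"
      using dia2(8) by cases auto
    \<comment> \<open>Here \<open>Dia A\<close> sits in the child while \<open>A\<close> is added to
      its parent.\<close>
    have "improves u P"
      using sub[OF dia2(4)] dia2(7) unfolding u P
      by (intro improves_add_fmls[where X = "Dia A"]) (auto simp: subfms_refl)
    moreover have "\<Xi>' = fill C P"
      using dia2(1) assms(2) by simp
    ultimately show ?thesis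
      by (rule lift[OF dia2(4)])
  next
    case (bdia2 C u v A P)
    obtain \<Gamma> \<Delta> L K where u: "u = Seq \<Gamma> (add_mset (Circ, Seq (finsert (BDia A) \<Delta>) L) K)"
      and P: "P = Seq (finsert A \<Gamma>) (add_mset (Circ, Seq (finsert (BDia A) \<Delta>) L) K)"
      using bdia2(8) by cases auto
    have "improves u P"
      using sub[OF bdia2(4)] bdia2(7) unfolding u P
      by (intro improves_add_fmls[where X = "BDia A"]) (auto simp: subfms_refl)
    moreover have "\<Xi>' = fill C P"
      using bdia2(1) assms(2) by simp
    ultimately show ?thesis
      by (rule lift[OF bdia2(4)])
  qed (use assms(2) in simp_all)
qed

end

section \<open>The body of \<open>Prove\<close> always has an action\<close>

lemma dkt_exists:
  shows "Atom a |\<in>| fmls u \<Longrightarrow> NegAtom a |\<in>| fmls u \<Longrightarrow> dkt (IdR a) [] u"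
    and "Or A B |\<in>| fmls u \<Longrightarrow> \<exists>P. dkt (OrR A B) [P] u"
    and "And A B |\<in>| fmls u \<Longrightarrow> \<exists>P Q. dkt (AndR A B) [P, Q] u"
    and "Box A |\<in>| fmls u \<Longrightarrow> \<exists>P. dkt (BoxR A) [P] u"
    and "BBox A |\<in>| fmls u \<Longrightarrow> \<exists>P. dkt (BBoxR A) [P] u"
    and "Dia A |\<in>| fmls u \<Longrightarrow> (Circ, v) \<in># children u \<Longrightarrow> \<exists>P. dkt (Dia1R A v) [P] u"
    and "BDia A |\<in>| fmls u \<Longrightarrow> (Bullet, v) \<in># children u \<Longrightarrow> \<exists>P. dkt (BDia1R A v) [P] u"
    and "(Bullet, v) \<in># children u \<Longrightarrow> Dia A |\<in>| fmls v \<Longrightarrow> \<exists>P. dkt (Dia2R A) [P] u"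
    and "(Circ, v) \<in># children u \<Longrightarrow> BDia A |\<in>| fmls v \<Longrightarrow> \<exists>P. dkt (BDia2R A) [P] u"
proof -
  obtain \<Gamma> K where u: "u = Seq \<Gamma> K" by (cases u)
  obtain \<Delta> L where v: "v = Seq \<Delta> L" by (cases v)
  \<comment> \<open>Guards speak of membership, whereas the rules display the principal formula by
    \<open>finsert\<close>. Inserting a formula already present changes nothing, so each node
    matches the conclusion of its rule.\<close>
  have ins: "finsert X \<Theta> = \<Theta>" if "X |\<in>| \<Theta>" for X :: "'a fm" and \<Theta>
    using that by auto
  show "dkt (IdR a) [] u" if "Atom a |\<in>| fmls u" "NegAtom a |\<in>| fmls u"
    using that u dkt.intros(1)[of a \<Gamma> K] by (simp add: ins)
  show "\<exists>P. dkt (OrR A B) [P] u" if "Or A B |\<in>| fmls u"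
    using that u dkt.intros(2)[of A B \<Gamma> K] by (auto simp: ins)
  show "\<exists>P Q. dkt (AndR A B) [P, Q] u" if "And A B |\<in>| fmls u"
    using that u dkt.intros(3)[of A B \<Gamma> K] by (auto simp: ins)
  show "\<exists>P. dkt (BoxR A) [P] u" if "Box A |\<in>| fmls u"
    using that u dkt.intros(4)[of A \<Gamma> K] by (auto simp: ins)
  show "\<exists>P. dkt (BBoxR A) [P] u" if "BBox A |\<in>| fmls u"
    using that u dkt.intros(5)[of A \<Gamma> K] by (auto simp: ins)
  show "\<exists>P. dkt (Dia1R A v) [P] u" if "Dia A |\<in>| fmls u" "(Circ, v) \<in># children u"
    using that u v dkt.intros(6)[of A \<Delta> L \<Gamma> "K - {#(Circ, v)#}"] by (auto simp: ins)
  show "\<exists>P. dkt (BDia1R A v) [P] u" if "BDia A |\<in>| fmls u" "(Bullet, v) \<in># children u"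
    using that u v dkt.intros(7)[of A \<Delta> L \<Gamma> "K - {#(Bullet, v)#}"] by (auto simp: ins)
  show "\<exists>P. dkt (Dia2R A) [P] u" if "(Bullet, v) \<in># children u" "Dia A |\<in>| fmls v"
    using that u v dkt.intros(8)[of A \<Gamma> \<Delta> L "K - {#(Bullet, v)#}"] by (auto simp: ins)
  show "\<exists>P. dkt (BDia2R A) [P] u" if "(Circ, v) \<in># children u" "BDia A |\<in>| fmls v"
    using that u v dkt.intros(9)[of A \<Gamma> \<Delta> L "K - {#(Circ, v)#}"] by (auto simp: ins)
qed

text \<open>The guards are exhaustive: if no action were possible, the failure of each stage would
  establish the condition guarding the next, until all nodes are saturated, realised and propagated
  and \<open>Return False\<close> is available.\<close>

lemma prove_body_total: "\<exists>act. prove_body \<Xi> act"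
proof (rule ccontr)
  assume stuck: "\<nexists>act. prove_body \<Xi> act"
  then have id: "\<not> id_applies \<Xi>"
    using prove_body.id by blast
  have sat: "saturated u" if u: "u \<in> nodes \<Xi>" for u
  proof -
    obtain C where C: "\<Xi> = fill C u" using u unfolding nodes_def by blast
    have "A |\<in>| fmls u \<and> B |\<in>| fmls u" if "Or A B |\<in>| fmls u" for A B
      using prove_body.disj[OF id C that] dkt_exists(2)[OF that] stuck by blast
    moreover have "A |\<in>| fmls u \<or> B |\<in>| fmls u" if "And A B |\<in>| fmls u" for A B
      using prove_body.conj[OF id C that] dkt_exists(3)[OF that] stuck by blast
    \<comment> \<open>The clause on atoms has no rule of its own in stage 2; it follows from the
      failure of the \<open>id\<close> test.\<close>
    moreover have "\<not> (Atom p |\<in>| fmls u \<and> NegAtom p |\<in>| fmls u)" for p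
      using id u dkt_exists(1)[of p u] by (auto simp: id_applies_def)
    ultimately show ?thesis
      unfolding saturated_def by blast
  qed
  then have all_sat: "\<forall>w\<in>nodes \<Xi>. saturated w" by blast
  have "realised u" if u: "u \<in> nodes \<Xi>" for u
  proof -
    obtain C where C: "\<Xi> = fill C u" using u unfolding nodes_def by blast
    have "box_realised u A" if "Box A |\<in>| fmls u" for A
      using prove_body.box[OF id all_sat C that] dkt_exists(4)[OF that] stuck by blast
    moreover have "bbox_realised u A" if "BBox A |\<in>| fmls u" for A
      using prove_body.bbox[OF id all_sat C that] dkt_exists(5)[OF that] stuck by blast
    ultimately show ?thesis
      unfolding realised_def by blast
  qed
  with sat have all_real: "\<forall>w\<in>nodes \<Xi>. saturated w \<and> realised w" by blast
  have "propagated u" if u: "u \<in> nodes \<Xi>" for u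
  proof -
    obtain C where C: "\<Xi> = fill C u" using u unfolding nodes_def by blast
    have "A |\<in>| fmls v" if "Dia A |\<in>| fmls u" "(Circ, v) \<in># children u" for A v
      using prove_body.dia1[OF id all_real C that] dkt_exists(6)[OF that] stuck by blast
    moreover have "A |\<in>| fmls v" if "BDia A |\<in>| fmls u" "(Bullet, v) \<in># children u" for A v
      using prove_body.bdia1[OF id all_real C that] dkt_exists(7)[OF that] stuck by blast
    moreover have "A |\<in>| fmls u" if "(Bullet, v) \<in># children u" "Dia A |\<in>| fmls v" for A v
      using prove_body.dia2[OF id all_real C that] dkt_exists(8)[OF that] stuck by blast
    moreover have "A |\<in>| fmls u" if "(Circ, v) \<in># children u" "BDia A |\<in>| fmls v" for A v
      using prove_body.bdia2[OF id all_real C that] dkt_exists(9)[OF that] stuck by blast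
    ultimately show ?thesis
      unfolding propagated_def by blast
  qed
  then show False
    using stuck all_real prove_body.fail[OF id] by blast
qed

theorem theorem7p4:
  fixes \<Xi> :: "'a nseq"
  shows "prove_terminates \<Xi>"
proof -
  \<comment> \<open>The subformula closure of the input serves the entire run, since
    \<open>improves\<close> keeps every later sequent inside \<open>F\<close>.\<close>
  define F where "F = (\<Union>A\<in>all_fmls \<Xi>. subfms A)"
  interpret closed_fmls F
  proof
    show "finite F" by (simp add: F_def finite_subfms)
    show "subfms A \<subseteq> F" if "A \<in> F" for A
      using that subfms_trans by (fastforce simp: F_def)
  qed
  have "all_fmls \<Xi>' \<subseteq> F \<Longrightarrow> prove_terminates \<Xi>'" for \<Xi>'
  \<comment> \<open>As calls preserve \<open>max_degree\<close>, caller and callee are measured with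
    the same bound, and the clause of \<open>improves\<close> for this \<open>d\<close> gives the
    descent.\<close>
  proof (induction "work (max_degree \<Xi>') \<Xi>'" arbitrary: \<Xi>' rule: less_induct)
    case less
    show ?case
    proof (rule prove_terminates.intros)
      show "\<exists>act. prove_body \<Xi>' act" by (rule prove_body_total)
    next
      fix act \<Xi>'' assume "prove_body \<Xi>' act" "\<Xi>'' \<in> calls act"
      then have "improves \<Xi>' \<Xi>''"
        using prove_body_improves less.prems by blast
      then show "prove_terminates \<Xi>''"
        by (intro less.hyps) (auto simp: improves_def)
    qed
  qed
  moreover have "all_fmls \<Xi> \<subseteq> F"
    using subfms_refl by (auto simp: F_def)
  ultimately show ?thesis by blast
qed

end
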